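(* Fix real numbers $p_0$, $\sigma_v>0$, $\sigma_u>0$ and $\sigma_\varepsilon\ge 0$. Let $(\beta,\lambda)$ be the unique linear equilibrium of the privacy-noisy Kyle model with these parameters (defined in the context), let $x=\beta(v-p_0)$ and $p=p_0+\lambda(x+u+\varepsilon)$, and let $\pi_M=\mathbb{E}[(p-v)(x+u)]$ be the market maker's (protocol's) expected profit per period. Then the protocol makes an expected loss ($\pi_M\le 0$) of size $$|\pi_M|=\frac{\sigma_v\,\sigma_\varepsilon^2}{2\sqrt{\sigma_u^2+\sigma_\varepsilon^2}}\ \ge\ 0,$$ with equality $|\pi_M|=0$ if and only if $\sigma_\varepsilon=0$. Consequently, for protocol break-even the total fees $F$ collected per period must satisfy $F\ge|\pi_M|$.
   Context: Model. On a probability space there are independent Gaussian random variables $v\sim N(p_0,\sigma_v^2)$ (asset value), $u\sim N(0,\sigma_u^2)$ (noise-trader flow) and $\varepsilon\sim N(0,\sigma_\varepsilon^2)$ (privacy noise), where $u$ is independent of $v$ and $\varepsilon$ is independent of $(v,u)$; if $\sigma_\varepsilon=0$ then $\varepsilon=0$ almost surely. An informed trader observes $v$ and submits an order $x$. Total order flow is $y=x+u$. The market maker observes only $\tilde y=x+u+\varepsilon$ and sets a price $p(\tilde y)$; the true flow $y$ is settled at that price. Linear equilibrium. A linear equilibrium is a pair $(\beta,\lambda)\in\mathbb{R}_{>0}^2$, with strategy $x=\beta(v-p_0)$ and pricing rule $p(\tilde y)=p_0+\lambda\tilde y$, such that: (1) with $\tilde y=\beta(v-p_0)+u+\varepsilon$,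 $p_0+\lambda\tilde y=\mathbb{E}[v\mid\tilde y]$ almost surely; (2) given $\lambda$, for each value of $v$ the order $x=\beta(v-p_0)$ maximizes over $x\in\mathbb{R}$ the quantity $\mathbb{E}[(v-p_0-\lambda(x+u+\varepsilon))\,x\mid v]$. The model has a unique linear equilibrium, namely $\lambda=\sigma_v/(2\sqrt{\sigma_u^2+\sigma_\varepsilon^2})$, $\beta=\sqrt{\sigma_u^2+\sigma_\varepsilon^2}/\sigma_v$. Break-even. Protocol break-even with total per-period fees $F\in\mathbb{R}$ means that the protocol's expected trading profit plus fees is nonnegative, $\pi_M+F\ge 0$, where $\pi_M=\mathbb{E}[(p-v)(x+u)]$ is computed at the linear equilibrium without fees, i.e. with $x=\beta(v-p_0)$, $p=p_0+\lambda(x+u+\varepsilon)$, $\lambda=\sigma_v/(2\sqrt{\sigma_u^2+\sigma_\varepsilon^2})$ and $\beta=\sqrt{\sigma_u^2+\sigma_\varepsilon^2}/\sigma_v$. The quantity $|\pi_M|$ is called the privacy subsidy. *)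

theory Defs
  imports "HOL-Probability.Probability"
begin

text \<open>
  \<open>v\<close> is the asset value, \<open>u\<close> the noise-trader flow and \<open>\<epsilon>\<close> the privacy noise. The
  \<open>normal_density\<close> of standard deviation 0 is not the point mass, hence the separate
  degenerate case for \<open>\<epsilon>\<close>. Mutual independence makes \<open>u\<close> independent of \<open>(v, \<epsilon>)\<close> and \<open>\<epsilon>\<close>
  independent of \<open>(v, u)\<close>; it also includes the measurability of \<open>\<epsilon>\<close>.
\<close>
locale noisy_kyle = prob_space M
  for M :: "'a measure" +
  fixes v u \<epsilon> :: "'a \<Rightarrow> real"
    and p\<^sub>0 \<sigma>\<^sub>v \<sigma>\<^sub>u \<sigma>\<^sub>\<epsilon> :: real
  assumes v_normal: "distributed M lborel v (normal_density p\<^sub>0 \<sigma>\<^sub>v)"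
    and u_normal: "distributed M lborel u (normal_density 0 \<sigma>\<^sub>u)"
    and eps_normal: "\<sigma>\<^sub>\<epsilon> > 0 \<Longrightarrow> distributed M lborel \<epsilon> (normal_density 0 \<sigma>\<^sub>\<epsilon>)"
    and eps_degenerate: "\<sigma>\<^sub>\<epsilon> = 0 \<Longrightarrow> AE \<omega> in M. \<epsilon> \<omega> = 0"
    and indep: "indep_vars (\<lambda>_. borel) (\<lambda>i. [v, u, \<epsilon>] ! i) {0, 1, 2 :: nat}"

definition cond_exp_given :: "'a measure \<Rightarrow> ('a \<Rightarrow> real) \<Rightarrow> ('a \<Rightarrow> real) \<Rightarrow> 'a \<Rightarrow> real" where
  "cond_exp_given M f X = real_cond_exp M (vimage_algebra (space M) X borel) f"

definition informed_order :: "('a \<Rightarrow> real) \<Rightarrow> real \<Rightarrow> real \<Rightarrow> 'a \<Rightarrow> real" where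
  "informed_order v p\<^sub>0 \<beta> = (\<lambda>\<omega>. \<beta> * (v \<omega> - p\<^sub>0))"

definition noisy_flow :: "('a \<Rightarrow> real) \<Rightarrow> ('a \<Rightarrow> real) \<Rightarrow> ('a \<Rightarrow> real) \<Rightarrow> 'a \<Rightarrow> real" where
  "noisy_flow x u \<epsilon> = (\<lambda>\<omega>. x \<omega> + u \<omega> + \<epsilon> \<omega>)"

definition linear_price :: "real \<Rightarrow> real \<Rightarrow> ('a \<Rightarrow> real) \<Rightarrow> 'a \<Rightarrow> real" where
  "linear_price p\<^sub>0 lam y = (\<lambda>\<omega>. p\<^sub>0 + lam * y \<omega>)"

definition informed_profit ::
  "('a \<Rightarrow> real) \<Rightarrow> ('a \<Rightarrow> real) \<Rightarrow> ('a \<Rightarrow> real) \<Rightarrow> real \<Rightarrow> real \<Rightarrow> ('a \<Rightarrow> real) \<Rightarrow> 'a \<Rightarrow> real" where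
  "informed_profit v u \<epsilon> p\<^sub>0 lam x =
    (\<lambda>\<omega>. (v \<omega> - linear_price p\<^sub>0 lam (noisy_flow x u \<epsilon>) \<omega>) * x \<omega>)"

text \<open>
  Conditional expectations are determined only up to null sets, which may depend on the
  deviation \<open>x\<close>; optimality for each value of \<open>v\<close> is therefore stated, for every real
  deviation \<open>x\<close>, as an almost sure inequality of conditional expectations given \<open>v\<close>.
\<close>
definition linear_equilibrium ::
  "'a measure \<Rightarrow> ('a \<Rightarrow> real) \<Rightarrow> ('a \<Rightarrow> real) \<Rightarrow> ('a \<Rightarrow> real) \<Rightarrow> real \<Rightarrow> real \<Rightarrow> real \<Rightarrow> bool" where
  "linear_equilibrium M v u \<epsilon> p\<^sub>0 \<beta> lam \<longleftrightarrow>
     \<beta> > 0 \<and> lam > 0 \<and>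
     (let y = noisy_flow (informed_order v p\<^sub>0 \<beta>) u \<epsilon> in
        AE \<omega> in M. linear_price p\<^sub>0 lam y \<omega> = cond_exp_given M v y \<omega>) \<and>
     (\<forall>x. AE \<omega> in M.
        cond_exp_given M (informed_profit v u \<epsilon> p\<^sub>0 lam (\<lambda>_. x)) v \<omega>
          \<le> cond_exp_given M (informed_profit v u \<epsilon> p\<^sub>0 lam (informed_order v p\<^sub>0 \<beta>)) v \<omega>)"

text \<open>The price is set from the noisy flow, but the true flow \<open>x + u\<close> is settled at it.\<close>
definition protocol_profit ::
  "'a measure \<Rightarrow> ('a \<Rightarrow> real) \<Rightarrow> ('a \<Rightarrow> real) \<Rightarrow> ('a \<Rightarrow> real) \<Rightarrow> real \<Rightarrow> real \<Rightarrow> real \<Rightarrow> real" where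
  "protocol_profit M v u \<epsilon> p\<^sub>0 \<beta> lam =
     (let x = informed_order v p\<^sub>0 \<beta>; p = linear_price p\<^sub>0 lam (noisy_flow x u \<epsilon>)
      in \<integral>\<omega>. (p \<omega> - v \<omega>) * (x \<omega> + u \<omega>) \<partial>M)"

definition break_even ::
  "'a measure \<Rightarrow> ('a \<Rightarrow> real) \<Rightarrow> ('a \<Rightarrow> real) \<Rightarrow> ('a \<Rightarrow> real) \<Rightarrow> real \<Rightarrow> real \<Rightarrow> real \<Rightarrow> real \<Rightarrow> bool" where
  "break_even M v u \<epsilon> p\<^sub>0 \<beta> lam F \<longleftrightarrow> protocol_profit M v u \<epsilon> p\<^sub>0 \<beta> lam + F \<ge> 0"

end

theory Submission
  imports Defs
begin

text \<open>
  Write \<open>w = v - p\<^sub>0\<close>, \<open>z = u + \<epsilon>\<close> and \<open>y = \<beta> w + z\<close>. No formula for Gaussian conditional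
  expectations is needed: testing the pricing condition \<open>p\<^sub>0 + \<lambda> y = E[v | y]\<close> against \<open>y\<close> gives
  \<open>E[y (w - \<lambda> y)] = 0\<close>, that is \<open>\<beta> \<sigma>\<^sub>v\<^sup>2 = \<lambda> (\<beta>\<^sup>2 \<sigma>\<^sub>v\<^sup>2 + \<sigma>\<^sub>u\<^sup>2 + \<sigma>\<^sub>\<epsilon>\<^sup>2)\<close>. As \<open>z\<close> is centred and
  independent of \<open>v\<close>, the trader's conditional profit from an order \<open>x\<close> is \<open>(w - \<lambda> x) x\<close>, whose
  maximality at \<open>x = \<beta> w\<close> forces \<open>2 \<lambda> \<beta> = 1\<close>. These two equations determine \<open>\<beta>\<close> and \<open>\<lambda>\<close>, and
  the protocol profit is the expectation of a quadratic form in the uncorrelated variables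
  \<open>w\<close>, \<open>u\<close>, \<open>\<epsilon>\<close>, which evaluates to \<open>- \<lambda> \<sigma>\<^sub>\<epsilon>\<^sup>2\<close>.
\<close>

section \<open>Gaussian moments and pairwise independence\<close>

lemma (in prob_space) normal_distributed_centred_moments:
  assumes \<sigma>: "0 < \<sigma>" and D: "distributed M lborel X (normal_density \<mu> \<sigma>)"
  shows "integrable M (\<lambda>\<omega>. X \<omega> - \<mu>)"
    and "integrable M (\<lambda>\<omega>. (X \<omega> - \<mu>)\<^sup>2)"
    and "expectation (\<lambda>\<omega>. X \<omega> - \<mu>) = 0"
    and "expectation (\<lambda>\<omega>. (X \<omega> - \<mu>)\<^sup>2) = \<sigma>\<^sup>2"
proof -
  have pow: "integrable M (\<lambda>\<omega>. (X \<omega> - \<mu>) ^ k)" for k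
    using distributed_integrable[OF D, of "\<lambda>x. (x - \<mu>) ^ k"] integrable_normal_moment[OF \<sigma>, of \<mu> k]
    by simp
  show int: "integrable M (\<lambda>\<omega>. X \<omega> - \<mu>)" using pow[of 1] by simp
  show "integrable M (\<lambda>\<omega>. (X \<omega> - \<mu>)\<^sup>2)" by (rule pow)
  have X: "integrable M X"
    using Bochner_Integration.integrable_add[OF int integrable_const[of \<mu>]] by simp
  have E: "expectation X = \<mu>" by (rule normal_distributed_expectation[OF \<sigma> D])
  show "expectation (\<lambda>\<omega>. X \<omega> - \<mu>) = 0" using X E by (simp add: prob_space)
  show "expectation (\<lambda>\<omega>. (X \<omega> - \<mu>)\<^sup>2) = \<sigma>\<^sup>2"
    using normal_distributed_variance[OF \<sigma> D] E by simp
qed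

lemma (in prob_space) indep_vars_imp_indep_var:
  fixes X :: "'i \<Rightarrow> 'a \<Rightarrow> real"
  assumes "indep_vars (\<lambda>_. borel) X I" and "i \<in> I" "j \<in> I" "i \<noteq> j"
  shows "indep_var borel (X i) borel (X j)"
  \<comment> \<open>The sum over the one-element index set \<open>{j}\<close> is \<open>X j\<close>
    itself.\<close>
  using indep_vars_sum[of "{j}" i X] indep_vars_subset[OF assms(1), of "{i, j}"] assms(2-) by simp

lemma (in prob_space) indep_var_compose_left:
  assumes "indep_var M\<^sub>1 X N Y" and "f \<in> measurable M\<^sub>1 M\<^sub>2"
  shows "indep_var M\<^sub>2 (\<lambda>\<omega>. f (X \<omega>)) N Y"
  using indep_var_compose[OF assms measurable_ident] unfolding comp_def id_def .

section \<open>Conditional expectation given a random variable\<close>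

lemma (in prob_space) subalgebra_vimage_algebra:
  assumes [measurable]: "X \<in> measurable M N"
  shows "subalgebra M (vimage_algebra (space M) X N)"
  unfolding subalgebra_def using sets_image_in_sets[OF refl assms] by simp

text \<open>Each event generated by \<open>X\<close> has an indicator that is a Borel function of
  \<open>X\<close>, hence independent of \<open>Y\<close>. Integrals of \<open>Y\<close> over such
  events therefore factor, which is the characterization of the constant as conditional
  expectation.\<close>

lemma (in prob_space) cond_exp_given_indep:
  assumes ind: "indep_var borel X borel Y" and Y: "integrable M Y"
  shows "AE \<omega> in M. cond_exp_given M Y X \<omega> = expectation Y"
proof -
  have X[measurable]: "X \<in> borel_measurable M" using indep_var_rv1[OF ind] .
  let ?F = "vimage_algebra (space M) X borel"
  interpret F: finite_measure_subalgebra M ?F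
    by unfold_locales (rule subalgebra_vimage_algebra[OF X])
  show ?thesis unfolding cond_exp_given_def
  proof (rule F.real_cond_exp_charact)
    fix A assume "A \<in> sets ?F"
    moreover have "sets ?F = {X -` B \<inter> space M | B. B \<in> sets borel}"
      by (rule sets_vimage_algebra2) simp
    ultimately obtain B where B: "B \<in> sets borel" and A: "A = X -` B \<inter> space M"
      by blast
    have indB: "indep_var borel (\<lambda>\<omega>. indicator B (X \<omega>) :: real) borel Y"
      by (rule indep_var_compose_left[OF ind]) (use B in measurable)
    have intB: "integrable M (\<lambda>\<omega>. indicator B (X \<omega>) :: real)"
      by (rule integrable_const_bound[where B=1]) (use B in \<open>auto simp: indicator_def\<close>)
    have "(\<integral>\<omega>\<in>A. Y \<omega> \<partial>M) = expectation (\<lambda>\<omega>. indicator B (X \<omega>) * Y \<omega>)"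
      unfolding set_lebesgue_integral_def
      by (rule Bochner_Integration.integral_cong) (auto simp: A indicator_def)
    also have "\<dots> = expectation (\<lambda>\<omega>. indicator B (X \<omega>)) * expectation Y"
      by (rule indep_var_lebesgue_integral[OF indB intB Y])
    also have "\<dots> = expectation (\<lambda>\<omega>. indicator B (X \<omega>) * expectation Y)"
      using intB by simp
    also have "\<dots> = (\<integral>\<omega>\<in>A. expectation Y \<partial>M)"
      unfolding set_lebesgue_integral_def
      by (rule Bochner_Integration.integral_cong) (auto simp: A indicator_def)
    finally show "(\<integral>\<omega>\<in>A. Y \<omega> \<partial>M) = (\<integral>\<omega>\<in>A. expectation Y \<partial>M)" .
  qed (use Y in auto)
qed

text \<open>Functions of \<open>X\<close> can be pulled out of the conditional expectation, and what
  remains of \<open>Y\<close> is its mean by independence. The trader's profit has this shape with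
  \<open>X = v\<close> and \<open>Y = u + \<epsilon>\<close>.\<close>

lemma (in prob_space) cond_exp_given_affine:
  fixes f g :: "real \<Rightarrow> real"
  assumes ind: "indep_var borel X borel Y"
    and Y: "integrable M Y"
    and [measurable]: "f \<in> borel_measurable borel" "g \<in> borel_measurable borel"
    and f: "integrable M (\<lambda>\<omega>. f (X \<omega>))" and g: "integrable M (\<lambda>\<omega>. g (X \<omega>))"
  shows "AE \<omega> in M. cond_exp_given M (\<lambda>\<omega>. f (X \<omega>) + g (X \<omega>) * Y \<omega>) X \<omega>
           = f (X \<omega>) + g (X \<omega>) * expectation Y"
proof -
  have X[measurable]: "X \<in> borel_measurable M" using indep_var_rv1[OF ind] .
  let ?F = "vimage_algebra (space M) X borel"
  interpret F: finite_measure_subalgebra M ?F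
    by unfold_locales (rule subalgebra_vimage_algebra[OF X])
  have [measurable]: "X \<in> borel_measurable ?F" by (rule measurable_vimage_algebra1) simp
  have "indep_var borel (\<lambda>\<omega>. g (X \<omega>)) borel Y"
    by (rule indep_var_compose_left[OF ind]) measurable
  then have gY: "integrable M (\<lambda>\<omega>. g (X \<omega>) * Y \<omega>)"
    using g Y by (rule indep_var_integrable)
  have 1: "AE \<omega> in M. real_cond_exp M ?F (\<lambda>\<omega>. f (X \<omega>) + g (X \<omega>) * Y \<omega>) \<omega>
      = real_cond_exp M ?F (\<lambda>\<omega>. f (X \<omega>)) \<omega> + real_cond_exp M ?F (\<lambda>\<omega>. g (X \<omega>) * Y \<omega>) \<omega>"
    using f gY by (rule F.real_cond_exp_add)
  have 2: "AE \<omega> in M. real_cond_exp M ?F (\<lambda>\<omega>. f (X \<omega>)) \<omega> = f (X \<omega>)"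
    using f by (rule F.real_cond_exp_F_meas) measurable
  have 3: "AE \<omega> in M. real_cond_exp M ?F (\<lambda>\<omega>. g (X \<omega>) * Y \<omega>) \<omega> = g (X \<omega>) * real_cond_exp M ?F Y \<omega>"
    by (rule F.real_cond_exp_mult) (use gY Y in auto)
  show ?thesis
    using 1 2 3 cond_exp_given_indep[OF ind Y] unfolding cond_exp_given_def by eventually_elim simp
qed

text \<open>Continuity and density extend the bound from rational to real \<open>x\<close>; it is
  then tested at the vertex \<open>w / (2 * k)\<close> of the parabola, where the value at
  \<open>b * w\<close> falls short by a multiple of a square. Rational \<open>x\<close> suffice, so
  an almost sure bound for each single \<open>x\<close> can be used.\<close>

lemma quadratic_max_imp:
  fixes w k c :: real
  assumes "0 < k" and max: "\<And>x. x \<in> \<rat> \<Longrightarrow> (w - k * x) * x \<le> (w - k * (b * w)) * (b * w)" and "w \<noteq> 0"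
  shows "2 * k * b = 1"
proof -
  let ?S = "{x. (w - k * x) * x \<le> (w - k * (b * w)) * (b * w)}"
  have "closed ?S" by (intro closed_Collect_le continuous_intros)
  then have "closure \<rat> \<subseteq> ?S" using max by (intro closure_minimal) auto
  then have "w / (2 * k) \<in> ?S" unfolding Rats_closure_real by blast
  then have "0 \<le> (w - k * (b * w)) * (b * w) - (w - k * (w / (2 * k))) * (w / (2 * k))" by simp
  also have "\<dots> = - (w\<^sup>2 * (2 * k * b - 1)\<^sup>2 / (4 * k))"
    using \<open>0 < k\<close> by (simp add: field_simps power2_eq_square)
  finally have "w\<^sup>2 * (2 * k * b - 1)\<^sup>2 \<le> 0"
    using \<open>0 < k\<close> by (simp add: divide_le_0_iff)
  then show ?thesis using \<open>w \<noteq> 0\<close> by (auto simp: mult_le_0_iff)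
qed

section \<open>First and second moments in the model\<close>

locale noisy_kyle_nondegenerate = noisy_kyle +
  assumes \<sigma>\<^sub>v_pos: "\<sigma>\<^sub>v > 0" and \<sigma>\<^sub>u_pos: "\<sigma>\<^sub>u > 0" and \<sigma>\<^sub>\<epsilon>_nonneg: "\<sigma>\<^sub>\<epsilon> \<ge> 0"
begin

abbreviation w :: "'a \<Rightarrow> real" where "w \<omega> \<equiv> v \<omega> - p\<^sub>0"

lemmas w_moments = normal_distributed_centred_moments[OF \<sigma>\<^sub>v_pos v_normal]
lemmas u_moments = normal_distributed_centred_moments[OF \<sigma>\<^sub>u_pos u_normal, simplified]

lemma indep_pairs:
  shows indep_vu: "indep_var borel v borel u"
    and indep_veps: "indep_var borel v borel \<epsilon>"
    and indep_ueps: "indep_var borel u borel \<epsilon>"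
  using indep_vars_imp_indep_var[OF indep, of 0 1] indep_vars_imp_indep_var[OF indep, of 0 2]
    indep_vars_imp_indep_var[OF indep, of 1 2]
  by simp_all

text \<open>Mutual independence is essential here: pairwise independence would not make
  \<open>v\<close> independent of a sum.\<close>

lemma indep_v_noise: "indep_var borel v borel (\<lambda>\<omega>. u \<omega> + \<epsilon> \<omega>)"
  using indep_vars_sum[of "{1, 2}" 0 "\<lambda>i. [v, u, \<epsilon>] ! i"] indep by simp

lemma measurable_vars [measurable]:
  "v \<in> borel_measurable M" "u \<in> borel_measurable M" "\<epsilon> \<in> borel_measurable M"
  using indep_var_rv1[OF indep_vu] indep_var_rv1[OF indep_ueps] indep_var_rv2[OF indep_ueps] by auto

text \<open>The Gaussian formulas require a positive standard deviation. For
  \<open>\<sigma>\<^sub>\<epsilon> = 0\<close> the noise agrees almost surely with zero, and the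
  same formulas result.\<close>

lemma eps_moments:
  shows "integrable M \<epsilon>" and "integrable M (\<lambda>\<omega>. (\<epsilon> \<omega>)\<^sup>2)"
    and "expectation \<epsilon> = 0" and "expectation (\<lambda>\<omega>. (\<epsilon> \<omega>)\<^sup>2) = \<sigma>\<^sub>\<epsilon>\<^sup>2"
proof -
  have "integrable M \<epsilon> \<and> integrable M (\<lambda>\<omega>. (\<epsilon> \<omega>)\<^sup>2) \<and> expectation \<epsilon> = 0 \<and>
    expectation (\<lambda>\<omega>. (\<epsilon> \<omega>)\<^sup>2) = \<sigma>\<^sub>\<epsilon>\<^sup>2"
  proof (cases "\<sigma>\<^sub>\<epsilon> = 0")
    case True
    note zero = eps_degenerate[OF True]
    have sq: "AE \<omega> in M. (\<epsilon> \<omega>)\<^sup>2 = 0" using zero by eventually_elim simp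
    have "integrable M \<epsilon> \<longleftrightarrow> integrable M (\<lambda>_. 0 :: real)"
      "integrable M (\<lambda>\<omega>. (\<epsilon> \<omega>)\<^sup>2) \<longleftrightarrow> integrable M (\<lambda>_. 0 :: real)"
      using zero sq by (intro integrable_cong_AE; simp)+
    then show ?thesis
      using True integral_eq_zero_AE[OF zero] integral_eq_zero_AE[OF sq] by simp
  next
    case False
    then have pos: "\<sigma>\<^sub>\<epsilon> > 0" using \<sigma>\<^sub>\<epsilon>_nonneg by simp
    show ?thesis
      using normal_distributed_centred_moments[OF pos eps_normal[OF pos]] by simp
  qed
  then show "integrable M \<epsilon>" "integrable M (\<lambda>\<omega>. (\<epsilon> \<omega>)\<^sup>2)" "expectation \<epsilon> = 0"
    "expectation (\<lambda>\<omega>. (\<epsilon> \<omega>)\<^sup>2) = \<sigma>\<^sub>\<epsilon>\<^sup>2"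
    by auto
qed

text \<open>By independence each expectation factors, and the second factor is centred.\<close>

lemma has_bochner_integral_products:
  shows "has_bochner_integral M (\<lambda>\<omega>. w \<omega> * u \<omega>) 0"
    and "has_bochner_integral M (\<lambda>\<omega>. w \<omega> * \<epsilon> \<omega>) 0"
    and "has_bochner_integral M (\<lambda>\<omega>. u \<omega> * \<epsilon> \<omega>) 0"
proof -
  have wu: "indep_var borel w borel u" and we: "indep_var borel w borel \<epsilon>"
    by (rule indep_var_compose_left[OF indep_vu] indep_var_compose_left[OF indep_veps], measurable)+
  show "has_bochner_integral M (\<lambda>\<omega>. w \<omega> * u \<omega>) 0"
    using indep_var_integrable[OF wu w_moments(1) u_moments(1)]
      indep_var_lebesgue_integral[OF wu w_moments(1) u_moments(1)] u_moments(3)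
    by (simp add: has_bochner_integral_iff)
  show "has_bochner_integral M (\<lambda>\<omega>. w \<omega> * \<epsilon> \<omega>) 0"
    using indep_var_integrable[OF we w_moments(1) eps_moments(1)]
      indep_var_lebesgue_integral[OF we w_moments(1) eps_moments(1)] eps_moments(3)
    by (simp add: has_bochner_integral_iff)
  show "has_bochner_integral M (\<lambda>\<omega>. u \<omega> * \<epsilon> \<omega>) 0"
    using indep_var_integrable[OF indep_ueps u_moments(1) eps_moments(1)]
      indep_var_lebesgue_integral[OF indep_ueps u_moments(1) eps_moments(1)] eps_moments(3)
    by (simp add: has_bochner_integral_iff)
qed

text \<open>Serves both the pricing condition and the protocol profit, which only differ in the
  coefficients.\<close>

lemma has_bochner_integral_quadratic_form:
  "has_bochner_integral M
     (\<lambda>\<omega>. a * (w \<omega>)\<^sup>2 + b * (u \<omega>)\<^sup>2 + c * (\<epsilon> \<omega>)\<^sup>2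
        + d * (w \<omega> * u \<omega>) + e * (w \<omega> * \<epsilon> \<omega>) + f * (u \<omega> * \<epsilon> \<omega>))
     (a * \<sigma>\<^sub>v\<^sup>2 + b * \<sigma>\<^sub>u\<^sup>2 + c * \<sigma>\<^sub>\<epsilon>\<^sup>2)"
proof -
  have sq: "has_bochner_integral M (\<lambda>\<omega>. (w \<omega>)\<^sup>2) (\<sigma>\<^sub>v\<^sup>2)"
    "has_bochner_integral M (\<lambda>\<omega>. (u \<omega>)\<^sup>2) (\<sigma>\<^sub>u\<^sup>2)"
    "has_bochner_integral M (\<lambda>\<omega>. (\<epsilon> \<omega>)\<^sup>2) (\<sigma>\<^sub>\<epsilon>\<^sup>2)"
    using w_moments u_moments eps_moments by (simp_all add: has_bochner_integral_iff)
  have "has_bochner_integral M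
     (\<lambda>\<omega>. a * (w \<omega>)\<^sup>2 + b * (u \<omega>)\<^sup>2 + c * (\<epsilon> \<omega>)\<^sup>2
        + d * (w \<omega> * u \<omega>) + e * (w \<omega> * \<epsilon> \<omega>) + f * (u \<omega> * \<epsilon> \<omega>))
     (a * \<sigma>\<^sub>v\<^sup>2 + b * \<sigma>\<^sub>u\<^sup>2 + c * \<sigma>\<^sub>\<epsilon>\<^sup>2 + d * 0 + e * 0 + f * 0)"
    by (intro has_bochner_integral_add has_bochner_integral_mult_right sq has_bochner_integral_products)
  then show ?thesis by simp
qed

text \<open>The law of \<open>v\<close> has a density, so it gives no mass to a point. At
  \<open>w = 0\<close> the trader's optimality would say nothing about
  \<open>\<beta>\<close>.\<close>

lemma AE_w_nonzero: "AE \<omega> in M. w \<omega> \<noteq> 0"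
proof -
  have "AE x in distr M lborel v. x \<noteq> p\<^sub>0"
    unfolding distributed_distr_eq_density[OF v_normal]
    by (subst AE_density) (use AE_lborel_singleton[of p\<^sub>0] in auto)
  then have "AE \<omega> in M. v \<omega> \<noteq> p\<^sub>0"
    by (subst (asm) AE_distr_iff) (auto simp: distributed_measurable[OF v_normal])
  then show ?thesis by eventually_elim simp
qed

section \<open>The two equilibrium equations\<close>

text \<open>The noise enters the profit only through \<open>- lam * \<xi> (v \<omega>) * (u \<omega>
  + \<epsilon> \<omega>)\<close>, which has conditional mean zero. A general function
  \<open>\<xi>\<close> of \<open>v\<close> covers both constant deviations and the equilibrium
  order.\<close>

lemma cond_exp_profit:
  fixes \<xi> :: "real \<Rightarrow> real"
  assumes [measurable]: "\<xi> \<in> borel_measurable borel" and "integrable M (\<lambda>\<omega>. \<xi> (v \<omega>))"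
    and "integrable M (\<lambda>\<omega>. (w \<omega> - lam * \<xi> (v \<omega>)) * \<xi> (v \<omega>))"
  shows "AE \<omega> in M. cond_exp_given M (informed_profit v u \<epsilon> p\<^sub>0 lam (\<lambda>\<omega>. \<xi> (v \<omega>))) v \<omega>
           = (w \<omega> - lam * \<xi> (v \<omega>)) * \<xi> (v \<omega>)"
proof -
  let ?z = "\<lambda>\<omega>. u \<omega> + \<epsilon> \<omega>"
  have z: "integrable M ?z" "expectation ?z = 0"
    using u_moments eps_moments by auto
  have eq: "informed_profit v u \<epsilon> p\<^sub>0 lam (\<lambda>\<omega>. \<xi> (v \<omega>))
      = (\<lambda>\<omega>. (w \<omega> - lam * \<xi> (v \<omega>)) * \<xi> (v \<omega>) + (- lam * \<xi> (v \<omega>)) * ?z \<omega>)"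
    by (simp add: informed_profit_def linear_price_def noisy_flow_def fun_eq_iff algebra_simps)
  show ?thesis
    unfolding eq
    using cond_exp_given_affine[OF indep_v_noise z(1),
        of "\<lambda>t. (t - p\<^sub>0 - lam * \<xi> t) * \<xi> t" "\<lambda>t. - lam * \<xi> t"] assms(2,3) z(2)
    by simp
qed

lemma equilibrium_order:
  assumes "linear_equilibrium M v u \<epsilon> p\<^sub>0 \<beta> lam"
  shows "2 * lam * \<beta> = 1"
proof -
  from assms have lam: "lam > 0"
    and opt: "AE \<omega> in M. cond_exp_given M (informed_profit v u \<epsilon> p\<^sub>0 lam (\<lambda>_. x)) v \<omega>
          \<le> cond_exp_given M (informed_profit v u \<epsilon> p\<^sub>0 lam (informed_order v p\<^sub>0 \<beta>)) v \<omega>" for x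
    unfolding linear_equilibrium_def by auto
  \<comment> \<open>At the order \<open>\<beta> * w \<omega>\<close> the profit net of noise is a
    multiple of the square of \<open>w \<omega>\<close>, hence integrable.\<close>
  have "integrable M (\<lambda>\<omega>. (\<beta> - lam * \<beta>\<^sup>2) * (w \<omega>)\<^sup>2)" using w_moments(2) by simp
  also have "(\<lambda>\<omega>. (\<beta> - lam * \<beta>\<^sup>2) * (w \<omega>)\<^sup>2) = (\<lambda>\<omega>. (w \<omega> - lam * (\<beta> * w \<omega>)) * (\<beta> * w \<omega>))"
    by (simp add: fun_eq_iff power2_eq_square algebra_simps)
  finally have eq: "AE \<omega> in M. cond_exp_given M
        (informed_profit v u \<epsilon> p\<^sub>0 lam (informed_order v p\<^sub>0 \<beta>)) v \<omega>
      = (w \<omega> - lam * (\<beta> * w \<omega>)) * (\<beta> * w \<omega>)"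
    unfolding informed_order_def
    using w_moments(1) by (intro cond_exp_profit[of "\<lambda>t. \<beta> * (t - p\<^sub>0)"]) simp_all
  have le: "AE \<omega> in M. (w \<omega> - lam * x) * x \<le> (w \<omega> - lam * (\<beta> * w \<omega>)) * (\<beta> * w \<omega>)" for x
  proof -
    have "integrable M (\<lambda>\<omega>. (w \<omega> - lam * x) * x)" using w_moments(1) by simp
    then have "AE \<omega> in M. cond_exp_given M (informed_profit v u \<epsilon> p\<^sub>0 lam (\<lambda>_. x)) v \<omega>
        = (w \<omega> - lam * x) * x"
      by (intro cond_exp_profit[of "\<lambda>_. x"]) simp_all
    with opt[of x] eq show ?thesis by eventually_elim simp
  qed
  \<comment> \<open>The null set in \<open>le\<close> depends on \<open>x\<close>; only countably many \<open>x\<close> can be treated at once.\<close>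
  have "AE \<omega> in M. \<forall>x\<in>\<rat>. (w \<omega> - lam * x) * x \<le> (w \<omega> - lam * (\<beta> * w \<omega>)) * (\<beta> * w \<omega>)"
    using le by (intro AE_ball_countable[THEN iffD2] countable_rat) auto
  with AE_w_nonzero have "AE \<omega> in M. 2 * lam * \<beta> = 1"
    by eventually_elim (rule quadratic_max_imp[OF lam], auto)
  \<comment> \<open>The equation does not depend on \<open>\<omega>\<close>, so on a probability
    space almost sure validity is validity.\<close>
  then show ?thesis by simp
qed

text \<open>In regression terms, \<open>lam\<close> times the variance of \<open>y\<close> equals
  the covariance of \<open>v\<close> and \<open>y\<close>.\<close>

lemma equilibrium_price:
  assumes "linear_equilibrium M v u \<epsilon> p\<^sub>0 \<beta> lam"
  shows "\<beta> * \<sigma>\<^sub>v\<^sup>2 = lam * (\<beta>\<^sup>2 * \<sigma>\<^sub>v\<^sup>2 + \<sigma>\<^sub>u\<^sup>2 + \<sigma>\<^sub>\<epsilon>\<^sup>2)"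
proof -
  define y where "y = noisy_flow (informed_order v p\<^sub>0 \<beta>) u \<epsilon>"
  have y: "y \<omega> = \<beta> * w \<omega> + u \<omega> + \<epsilon> \<omega>" for \<omega>
    by (simp add: y_def noisy_flow_def informed_order_def)
  have [measurable]: "y \<in> borel_measurable M" unfolding y by measurable
  let ?F = "vimage_algebra (space M) y borel"
  interpret F: finite_measure_subalgebra M ?F
    by unfold_locales (rule subalgebra_vimage_algebra, measurable)
  have y_F: "y \<in> borel_measurable ?F" by (rule measurable_vimage_algebra1) simp
  have price: "AE \<omega> in M. real_cond_exp M ?F v \<omega> = p\<^sub>0 + lam * y \<omega>"
    using assms unfolding linear_equilibrium_def Let_def y_def[symmetric] linear_price_def
      cond_exp_given_def by auto
  have int_y: "integrable M y"
    unfolding y using w_moments(1) u_moments(1) eps_moments(1) by simp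
  have yw: "has_bochner_integral M (\<lambda>\<omega>. y \<omega> * w \<omega>) (\<beta> * \<sigma>\<^sub>v\<^sup>2)"
    using has_bochner_integral_quadratic_form[of \<beta> 0 0 1 1 0]
    by (simp add: y power2_eq_square algebra_simps)
  have yy: "has_bochner_integral M (\<lambda>\<omega>. y \<omega> * y \<omega>) (\<beta>\<^sup>2 * \<sigma>\<^sub>v\<^sup>2 + \<sigma>\<^sub>u\<^sup>2 + \<sigma>\<^sub>\<epsilon>\<^sup>2)"
    using has_bochner_integral_quadratic_form[of "\<beta>\<^sup>2" 1 1 "2 * \<beta>" "2 * \<beta>" 2]
    by (simp add: y power2_eq_square algebra_simps)
  \<comment> \<open>The conditional expectation concerns \<open>v\<close> rather than
    \<open>w\<close>; the extra term \<open>p\<^sub>0 * expectation y\<close> occurs on both sides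
    and cancels at the end.\<close>
  have yv: "has_bochner_integral M (\<lambda>\<omega>. y \<omega> * v \<omega>) (\<beta> * \<sigma>\<^sub>v\<^sup>2 + p\<^sub>0 * expectation y)"
  proof -
    have "(\<lambda>\<omega>. y \<omega> * v \<omega>) = (\<lambda>\<omega>. y \<omega> * w \<omega> + p\<^sub>0 * y \<omega>)"
      by (simp add: fun_eq_iff algebra_simps)
    then show ?thesis using yw int_y by (simp add: has_bochner_integral_iff)
  qed
  have "\<beta> * \<sigma>\<^sub>v\<^sup>2 + p\<^sub>0 * expectation y = expectation (\<lambda>\<omega>. y \<omega> * v \<omega>)"
    using yv by (simp add: has_bochner_integral_iff)
  \<comment> \<open>\<open>y\<close> is measurable for the sigma-algebra it generates, so it is an
    admissible test function.\<close>
  also have "\<dots> = expectation (\<lambda>\<omega>. y \<omega> * real_cond_exp M ?F v \<omega>)"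
    by (rule F.real_cond_exp_intg(2)[symmetric]) (use yv y_F in \<open>auto simp: has_bochner_integral_iff\<close>)
  also have "\<dots> = expectation (\<lambda>\<omega>. p\<^sub>0 * y \<omega> + lam * (y \<omega> * y \<omega>))"
  proof (rule integral_cong_AE)
    show "AE \<omega> in M. y \<omega> * real_cond_exp M ?F v \<omega> = p\<^sub>0 * y \<omega> + lam * (y \<omega> * y \<omega>)"
      using price by eventually_elim (simp add: algebra_simps)
  qed simp_all
  also have "\<dots> = p\<^sub>0 * expectation y + lam * (\<beta>\<^sup>2 * \<sigma>\<^sub>v\<^sup>2 + \<sigma>\<^sub>u\<^sup>2 + \<sigma>\<^sub>\<epsilon>\<^sup>2)"
    using int_y yy by (simp add: has_bochner_integral_iff)
  finally show ?thesis by simp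
qed

section \<open>Closed form of the slope and the protocol profit\<close>

lemma equilibrium_price_slope:
  assumes eq: "linear_equilibrium M v u \<epsilon> p\<^sub>0 \<beta> lam"
  shows "lam = \<sigma>\<^sub>v / (2 * sqrt (\<sigma>\<^sub>u\<^sup>2 + \<sigma>\<^sub>\<epsilon>\<^sup>2))"
proof -
  let ?S = "\<sigma>\<^sub>u\<^sup>2 + \<sigma>\<^sub>\<epsilon>\<^sup>2"
  have lam: "lam > 0" using eq by (simp add: linear_equilibrium_def)
  have S: "?S > 0" using \<sigma>\<^sub>u_pos by (simp add: add_pos_nonneg)
  have \<beta>: "\<beta> = 1 / (2 * lam)" using equilibrium_order[OF eq] lam by (simp add: field_simps)
  have "lam * \<sigma>\<^sub>v\<^sup>2 = lam * ((2 * lam)\<^sup>2 * ?S)"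
    using equilibrium_price[OF eq] lam unfolding \<beta> by (simp add: field_simps power2_eq_square)
  then have "\<sigma>\<^sub>v\<^sup>2 = (2 * lam)\<^sup>2 * ?S" using lam by (simp del: power_mult_distrib)
  \<comment> \<open>Positivity of \<open>\<sigma>\<^sub>v\<close> and \<open>lam\<close> selects the
    root.\<close>
  then have "\<sigma>\<^sub>v = 2 * lam * sqrt ?S"
    using \<sigma>\<^sub>v_pos lam by (metis abs_of_pos real_sqrt_abs real_sqrt_mult mult_pos_pos zero_less_numeral)
  then show ?thesis using S \<sigma>\<^sub>u_pos by (simp add: field_simps)
qed

text \<open>The noise moves the price but not the settled flow, so the profit has no term in the
  square of \<open>\<epsilon>\<close>. Its variance does occur in the pricing equation, and the loss
  is exactly this mismatch.\<close>

lemma protocol_profit_equilibrium: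
  assumes eq: "linear_equilibrium M v u \<epsilon> p\<^sub>0 \<beta> lam"
  shows "protocol_profit M v u \<epsilon> p\<^sub>0 \<beta> lam = - (lam * \<sigma>\<^sub>\<epsilon>\<^sup>2)"
proof -
  have "protocol_profit M v u \<epsilon> p\<^sub>0 \<beta> lam = expectation
     (\<lambda>\<omega>. (lam * \<beta>\<^sup>2 - \<beta>) * (w \<omega>)\<^sup>2 + lam * (u \<omega>)\<^sup>2 + 0 * (\<epsilon> \<omega>)\<^sup>2
        + (2 * lam * \<beta> - 1) * (w \<omega> * u \<omega>) + lam * \<beta> * (w \<omega> * \<epsilon> \<omega>) + lam * (u \<omega> * \<epsilon> \<omega>))"
    unfolding protocol_profit_def Let_def linear_price_def noisy_flow_def informed_order_def
    by (rule Bochner_Integration.integral_cong) (simp_all add: power2_eq_square algebra_simps)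
  also have "\<dots> = (lam * \<beta>\<^sup>2 - \<beta>) * \<sigma>\<^sub>v\<^sup>2 + lam * \<sigma>\<^sub>u\<^sup>2 + 0 * \<sigma>\<^sub>\<epsilon>\<^sup>2"
    by (rule has_bochner_integral_integral_eq[OF has_bochner_integral_quadratic_form])
  also have "\<dots> = - (lam * \<sigma>\<^sub>\<epsilon>\<^sup>2)"
    using equilibrium_price[OF eq] by (simp add: algebra_simps)
  finally show ?thesis .
qed

end

theorem theorem2:
  fixes M :: "'a measure" and v u \<epsilon> :: "'a \<Rightarrow> real"
    and p\<^sub>0 \<sigma>\<^sub>v \<sigma>\<^sub>u \<sigma>\<^sub>\<epsilon> \<beta> lam :: real
  assumes "\<sigma>\<^sub>v > 0" and "\<sigma>\<^sub>u > 0" and "\<sigma>\<^sub>\<epsilon> \<ge> 0"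
    and "noisy_kyle M v u \<epsilon> p\<^sub>0 \<sigma>\<^sub>v \<sigma>\<^sub>u \<sigma>\<^sub>\<epsilon>"
    and "linear_equilibrium M v u \<epsilon> p\<^sub>0 \<beta> lam"
  shows "let \<pi>\<^sub>M = protocol_profit M v u \<epsilon> p\<^sub>0 \<beta> lam in
           \<pi>\<^sub>M \<le> 0 \<and>
           \<bar>\<pi>\<^sub>M\<bar> = \<sigma>\<^sub>v * \<sigma>\<^sub>\<epsilon>\<^sup>2 / (2 * sqrt (\<sigma>\<^sub>u\<^sup>2 + \<sigma>\<^sub>\<epsilon>\<^sup>2)) \<and>
           \<sigma>\<^sub>v * \<sigma>\<^sub>\<epsilon>\<^sup>2 / (2 * sqrt (\<sigma>\<^sub>u\<^sup>2 + \<sigma>\<^sub>\<epsilon>\<^sup>2)) \<ge> 0 \<and>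
           (\<bar>\<pi>\<^sub>M\<bar> = 0 \<longleftrightarrow> \<sigma>\<^sub>\<epsilon> = 0) \<and>
           (\<forall>F. break_even M v u \<epsilon> p\<^sub>0 \<beta> lam F \<longrightarrow> F \<ge> \<bar>\<pi>\<^sub>M\<bar>)"
proof -
  interpret noisy_kyle M v u \<epsilon> p\<^sub>0 \<sigma>\<^sub>v \<sigma>\<^sub>u \<sigma>\<^sub>\<epsilon> by fact
  interpret noisy_kyle_nondegenerate M v u \<epsilon> p\<^sub>0 \<sigma>\<^sub>v \<sigma>\<^sub>u \<sigma>\<^sub>\<epsilon>
    by unfold_locales fact+
  have lam: "lam > 0" using assms(5) by (simp add: linear_equilibrium_def)
  note profit = protocol_profit_equilibrium[OF assms(5)]
  have size: "lam * \<sigma>\<^sub>\<epsilon>\<^sup>2 = \<sigma>\<^sub>v * \<sigma>\<^sub>\<epsilon>\<^sup>2 / (2 * sqrt (\<sigma>\<^sub>u\<^sup>2 + \<sigma>\<^sub>\<epsilon>\<^sup>2))"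
    using equilibrium_price_slope[OF assms(5)] by simp
  \<comment> \<open>With the closed form folded back into
    \<open>lam * \<sigma>\<^sub>\<epsilon>\<^sup>2\<close>, every claim follows from
    \<open>lam > 0\<close>.\<close>
  have "lam * \<sigma>\<^sub>\<epsilon>\<^sup>2 \<ge> 0" using lam by simp
  then show ?thesis
    using lam unfolding Let_def break_even_def profit size[symmetric] by auto
qed

end
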